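(* Let $G$ be a finite abelian group with identity $e$, and let $\rho_1,\ldots,\rho_r$ be the irreducible complex representations of $G$ (all one-dimensional, regarded as homomorphisms $G\to\mathbb{C}^\times$), with $\rho_1$ the trivial representation. Let $p$ be a probability distribution on $G$ such that the random walk on $G$ generated by $p$ is irreducible. Then for every $g\in G$, $$\mathbf{E}_e[\tau_g]=\sum_{i=2}^{r}\frac{1-\rho_i(g^{-1})}{1-\hat p(\rho_i)}.$$
   Context: The random walk on a finite group $G$ generated by a probability distribution $p$ on $G$ is the discrete-time Markov chain $(X_t)_{t\ge 0}$ with state space $G$ and transition probabilities $P(g,h)=p(hg^{-1})$. It is called irreducible if it is an irreducible Markov chain. For $g\in G$, $\tau_g=\min\{t\ge 0: X_t=g\}$ is the hitting time of $g$, and $\mathbf{E}_h$ denotes expectation for the walk started at $X_0=h$. The list $\rho_1,\dots,\rho_r$ contains one representative of each isomorphism class of irreducible representations. The Fourier transform of a function $f$ on $G$ at a representation $\rho$ is $\hat f(\rho)=\sum_{g\in G} f(g)\rho(g)$. *)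

theory Defs
  imports "HOL-Probability.Probability" "HOL-Algebra.Group" "Jordan_Normal_Form.VS_Connect"
begin

definition general_linear :: "nat \<Rightarrow> complex mat monoid" where
  "general_linear n = units_of (ring_mat TYPE(complex) n ())"

definition representation :: "('a, 'b) monoid_scheme \<Rightarrow> nat \<Rightarrow> ('a \<Rightarrow> complex mat) \<Rightarrow> bool" where
  "representation G n \<rho> \<longleftrightarrow> \<rho> \<in> hom G (general_linear n)"

definition invariant_subspace ::
  "('a, 'b) monoid_scheme \<Rightarrow> nat \<Rightarrow> ('a \<Rightarrow> complex mat) \<Rightarrow> complex vec set \<Rightarrow> bool" where
  "invariant_subspace G n \<rho> W \<longleftrightarrow>
     subspace class_ring W (module_vec TYPE(complex) n) \<and>
     (\<forall>g\<in>carrier G. \<forall>v\<in>W. \<rho> g *\<^sub>v v \<in> W)"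

definition irreducible_rep :: "('a, 'b) monoid_scheme \<Rightarrow> nat \<Rightarrow> ('a \<Rightarrow> complex mat) \<Rightarrow> bool" where
  "irreducible_rep G n \<rho> \<longleftrightarrow>
     n > 0 \<and> representation G n \<rho> \<and>
     (\<forall>W. invariant_subspace G n \<rho> W \<longrightarrow> W = {0\<^sub>v n} \<or> W = carrier_vec n)"

definition isomorphic_reps ::
  "('a, 'b) monoid_scheme \<Rightarrow> nat \<Rightarrow> ('a \<Rightarrow> complex mat) \<Rightarrow> nat \<Rightarrow> ('a \<Rightarrow> complex mat) \<Rightarrow> bool" where
  "isomorphic_reps G n \<rho> m \<sigma> \<longleftrightarrow>
     n = m \<and> (\<exists>T\<in>carrier (general_linear n). \<forall>g\<in>carrier G. T * \<rho> g = \<sigma> g * T)"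

(* The indices run over 1..r; rho i has degree d i. *)
definition irreps_list ::
  "('a, 'b) monoid_scheme \<Rightarrow> nat \<Rightarrow> (nat \<Rightarrow> nat) \<Rightarrow> (nat \<Rightarrow> 'a \<Rightarrow> complex mat) \<Rightarrow> bool" where
  "irreps_list G r d \<rho> \<longleftrightarrow>
     (\<forall>i\<in>{1..r}. irreducible_rep G (d i) (\<rho> i)) \<and>
     (\<forall>n \<sigma>. irreducible_rep G n \<sigma> \<longrightarrow> (\<exists>!i. i \<in> {1..r} \<and> isomorphic_reps G n \<sigma> (d i) (\<rho> i)))"

definition fourier ::
  "('a, 'b) monoid_scheme \<Rightarrow> ('a \<Rightarrow> complex) \<Rightarrow> nat \<Rightarrow> ('a \<Rightarrow> complex mat) \<Rightarrow> complex mat" where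
  "fourier G f n \<rho> = mat n n (\<lambda>(j, k). \<Sum>g\<in>carrier G. f g * \<rho> g $$ (j, k))"

definition walk_kernel :: "('a, 'b) monoid_scheme \<Rightarrow> 'a pmf \<Rightarrow> 'a \<Rightarrow> 'a \<Rightarrow> real" where
  "walk_kernel G p g h = pmf p (h \<otimes>\<^bsub>G\<^esub> inv\<^bsub>G\<^esub> g)"

primrec kernel_power :: "'a set \<Rightarrow> ('a \<Rightarrow> 'a \<Rightarrow> real) \<Rightarrow> nat \<Rightarrow> 'a \<Rightarrow> 'a \<Rightarrow> real" where
  "kernel_power S P 0 x y = (if x = y then 1 else 0)"
| "kernel_power S P (Suc t) x y = (\<Sum>z\<in>S. P x z * kernel_power S P t z y)"

definition irreducible_kernel :: "'a set \<Rightarrow> ('a \<Rightarrow> 'a \<Rightarrow> real) \<Rightarrow> bool" where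
  "irreducible_kernel S P \<longleftrightarrow> (\<forall>x\<in>S. \<forall>y\<in>S. \<exists>t. kernel_power S P t x y > 0)"

definition markov_chain ::
  "'w measure \<Rightarrow> 'a set \<Rightarrow> ('a \<Rightarrow> 'a \<Rightarrow> real) \<Rightarrow> 'a \<Rightarrow> (nat \<Rightarrow> 'w \<Rightarrow> 'a) \<Rightarrow> bool" where
  "markov_chain M S P x0 X \<longleftrightarrow>
     prob_space M \<and>
     (\<forall>t. X t \<in> measurable M (count_space S)) \<and>
     (AE \<omega> in M. X 0 \<omega> = x0) \<and>
     (\<forall>t x. \<forall>y\<in>S. measure M {\<omega> \<in> space M. \<forall>s\<le>t. X s \<omega> = x s} > 0 \<longrightarrow>
        cond_prob M (\<lambda>\<omega>. X (Suc t) \<omega> = y) (\<lambda>\<omega>. \<forall>s\<le>t. X s \<omega> = x s) = P (x t) y)"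

(* Infinity if g is never hit: the infimum of the empty set of extended naturals is infinity. *)
definition hitting_time :: "(nat \<Rightarrow> 'w \<Rightarrow> 'a) \<Rightarrow> 'a \<Rightarrow> 'w \<Rightarrow> enat" where
  "hitting_time X g \<omega> = (INF t\<in>{t. X t \<omega> = g}. enat t)"

definition expected_hitting_time :: "'w measure \<Rightarrow> (nat \<Rightarrow> 'w \<Rightarrow> 'a) \<Rightarrow> 'a \<Rightarrow> ennreal" where
  "expected_hitting_time M X g = (\<integral>\<^sup>+ \<omega>. ennreal_of_enat (hitting_time X g \<omega>) \<partial>M)"

end

theory Submission
  imports Defs "HOL-Algebra.Multiplicative_Group" "Jordan_Normal_Form.Spectral_Radius"
begin

text \<open>
  The proof rests on a stopping argument. Let \<open>h\<close> be any function on a finite state space with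
  \<open>h g = 0\<close> and \<open>h = 1 + P h\<close> off \<open>g\<close>. With \<open>\<tau>\<close> the hitting time of \<open>g\<close>, each step before \<open>\<tau>\<close>
  lowers the expectation of \<open>h\<close> at the stopped chain by the probability that the chain is still
  running, so that
  \<open>(\<Sum>s<t. Prob (\<tau> > s)) = h x0 - E (h (X t); \<tau> > t)\<close>. The last term is at most a constant times
  \<open>Prob (\<tau> > t)\<close>. Hence the partial sums are bounded, \<open>Prob (\<tau> > t)\<close> tends to \<open>0\<close>, and
  \<open>E \<tau> = h x0\<close> (\<open>expected_hitting_time_eqI\<close>). The existence of \<open>h\<close> alone forces the
  expected hitting time to be finite, and the uniqueness of \<open>h\<close> comes out as a by-product at the
  starting point.

  It remains to exhibit \<open>h\<close>. For the walk on a finite abelian group take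
  \<open>h x = (\<Sum>\<psi>. (1 - \<psi> (x \<otimes> inv g)) / (1 - pf \<psi>))\<close>, summed over the nontrivial characters, where
  \<open>pf \<psi>\<close> is the Fourier transform of \<open>p\<close> at \<open>\<psi>\<close>. Characters are eigenfunctions of the transition
  operator, with eigenvalue \<open>pf \<psi>\<close>, so \<open>h - P h\<close> at \<open>x\<close> equals \<open>- (\<Sum>\<psi>. \<psi> (x \<otimes> inv g))\<close>.
  This is \<open>1\<close> for \<open>x \<noteq> g\<close>, because the sum over all characters, the trivial one included, vanishes
  away from the identity (\<open>sum_all_characters_eq_0\<close>). The denominators are nonzero because
  \<open>pf \<psi> = 1\<close> forces \<open>\<psi>\<close> to be \<open>1\<close> on the support of \<open>p\<close>, hence along every possible path of
  the walk (\<open>walk_fourier_eq_1_imp_trivial\<close>).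

  The vanishing of the sum needs a character that separates a given element from the identity. It is
  found as the eigenvalue system of a common eigenfunction of all translations of the group
  (\<open>group_character_separates\<close>). Finally, irreducible representations of an abelian group have
  degree \<open>1\<close>, because the eigenspaces of each group element are invariant
  (\<open>irreducible_rep_degree\<close>), so that a full list of irreducible representations is a list of all
  characters without repetition.
\<close>

section \<open>Expected hitting times from solutions of a linear system\<close>

lemma markov_chain_pred_state:
  assumes "markov_chain M S P x0 X"
  shows "Measurable.pred M (\<lambda>\<omega>. X t \<omega> = x)"
proof -
  have X: "X t \<in> measurable M (count_space S)"
    using assms by (simp add: markov_chain_def)
  have "{\<omega> \<in> space M. X t \<omega> = x} = X t -` ({x} \<inter> S) \<inter> space M"
    using measurable_space[OF X] by auto
  also have "\<dots> \<in> sets M"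
    using X by (rule measurable_sets) auto
  finally show ?thesis by (simp add: pred_def)
qed

text \<open>
  The definition of a Markov chain conditions on a complete path. The event of staying in \<open>A\<close> and
  being at \<open>x\<close> at time \<open>t\<close> is a finite disjoint union of path events, all of which end in \<open>x\<close> and
  so contribute the same factor \<open>P x y\<close>.
\<close>

lemma markov_chain_step_avoiding:
  assumes mc: "markov_chain M S P x0 X" and S: "finite S" and y: "y \<in> S"
  shows "measure M {\<omega> \<in> space M. (\<forall>s\<le>t. X s \<omega> \<in> A) \<and> X t \<omega> = x \<and> X (Suc t) \<omega> = y} =
    P x y * measure M {\<omega> \<in> space M. (\<forall>s\<le>t. X s \<omega> \<in> A) \<and> X t \<omega> = x}"
proof -
  interpret prob_space M using mc by (simp add: markov_chain_def)
  have X: "X s \<in> measurable M (count_space S)" for s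
    using mc by (simp add: markov_chain_def)
  note [measurable] = markov_chain_pred_state[OF mc]
  define C where "C w = {\<omega> \<in> space M. \<forall>s\<le>t. X s \<omega> = w s}" for w
  define N where "N = {\<omega> \<in> space M. X (Suc t) \<omega> = y}"
  define W where "W = {w \<in> {..t} \<rightarrow>\<^sub>E S. (\<forall>s\<le>t. w s \<in> A) \<and> w t = x}"
  have [measurable]: "C w \<in> sets M" "N \<in> sets M" for w
    unfolding C_def N_def by measurable
  have finW: "finite W"
    unfolding W_def using S by (auto intro!: finite_subset[OF _ finite_PiE[of "{..t}" "\<lambda>_. S"]])
  \<comment> \<open>Conditional probabilities are prescribed for paths of positive probability only; for the other
    paths both sides vanish.\<close>
  have path: "measure M (C w \<inter> N) = P (w t) y * measure M (C w)" for w
  proof (cases "measure M (C w) > 0")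
    case True
    have "cond_prob M (\<lambda>\<omega>. X (Suc t) \<omega> = y) (\<lambda>\<omega>. \<forall>s\<le>t. X s \<omega> = w s) = P (w t) y"
      using mc True y unfolding markov_chain_def C_def by blast
    moreover have "{\<omega> \<in> space M. X (Suc t) \<omega> = y \<and> (\<forall>s\<le>t. X s \<omega> = w s)} = C w \<inter> N"
      by (auto simp: C_def N_def)
    ultimately show ?thesis
      using True by (simp add: cond_prob_def flip: C_def) (simp add: field_simps)
  next
    case False
    then have "measure M (C w) = 0" by (simp add: zero_less_measure_iff)
    moreover have "measure M (C w \<inter> N) \<le> measure M (C w)"
      by (rule finite_measure_mono) auto
    ultimately show ?thesis
      using measure_nonneg[of M "C w \<inter> N"] by simp
  qed
  have disj: "disjoint_family_on C W"
  proof (unfold disjoint_family_on_def, intro ballI impI equals0I)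
    fix v w \<omega> assume vw: "v \<in> W" "w \<in> W" "v \<noteq> w" and \<omega>: "\<omega> \<in> C v \<inter> C w"
    have "v = w"
    proof (rule PiE_ext)
      show "v \<in> {..t} \<rightarrow>\<^sub>E S" "w \<in> {..t} \<rightarrow>\<^sub>E S"
        using vw by (auto simp: W_def)
      fix s assume "s \<in> {..t}"
      then have "X s \<omega> = v s" "X s \<omega> = w s"
        using \<omega> by (auto simp: C_def)
      then show "v s = w s" by simp
    qed
    then show False using vw(3) by contradiction
  qed
  have "{\<omega> \<in> space M. (\<forall>s\<le>t. X s \<omega> \<in> A) \<and> X t \<omega> = x} \<subseteq> (\<Union>w\<in>W. C w)"
  proof
    fix \<omega> assume \<omega>: "\<omega> \<in> {\<omega> \<in> space M. (\<forall>s\<le>t. X s \<omega> \<in> A) \<and> X t \<omega> = x}"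
    then have "restrict (\<lambda>s. X s \<omega>) {..t} \<in> W"
      using measurable_space[OF X] by (auto simp: W_def)
    moreover have "\<omega> \<in> C (restrict (\<lambda>s. X s \<omega>) {..t})"
      using \<omega> by (auto simp: C_def)
    ultimately show "\<omega> \<in> (\<Union>w\<in>W. C w)" by blast
  qed
  then have un: "{\<omega> \<in> space M. (\<forall>s\<le>t. X s \<omega> \<in> A) \<and> X t \<omega> = x} = (\<Union>w\<in>W. C w)"
    by (auto simp: C_def W_def)
  then have unN: "{\<omega> \<in> space M. (\<forall>s\<le>t. X s \<omega> \<in> A) \<and> X t \<omega> = x \<and> X (Suc t) \<omega> = y} =
      (\<Union>w\<in>W. C w \<inter> N)"
    by (auto simp: N_def)
  have "measure M (\<Union>w\<in>W. C w \<inter> N) = (\<Sum>w\<in>W. measure M (C w \<inter> N))"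
    using finW disj by (intro finite_measure_finite_Union) (auto simp: disjoint_family_on_def)
  also have "\<dots> = (\<Sum>w\<in>W. P x y * measure M (C w))"
    by (intro sum.cong) (auto simp: path W_def)
  also have "\<dots> = P x y * measure M (\<Union>w\<in>W. C w)"
    using finW disj by (subst finite_measure_finite_Union) (auto simp: sum_distrib_left)
  finally show ?thesis using un unN by simp
qed

text \<open>
  This is optional stopping in the form of an exact telescoping identity. The value \<open>q t\<close> is the
  probability that \<open>g\<close> has not been hit by time \<open>t\<close>, and \<open>a t\<close> is the expectation of \<open>h (X t)\<close> on
  that event. The equation for \<open>h\<close> gives \<open>a (t + 1) = a t - q t\<close>, and \<open>\<bar>a t\<bar>\<close> is bounded by a multiple
  of \<open>q t\<close>; thus \<open>q\<close> is summable, \<open>a\<close> tends to \<open>0\<close> and the sum of \<open>q\<close> is \<open>a 0 = h x0\<close>.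
\<close>

lemma expected_hitting_time_eqI:
  fixes h :: "'a \<Rightarrow> complex"
  assumes mc: "markov_chain M S P x0 X" and S: "finite S"
    and hg: "h g = 0"
    and h: "\<And>x. x \<in> S \<Longrightarrow> x \<noteq> g \<Longrightarrow> h x = 1 + (\<Sum>y\<in>S. complex_of_real (P x y) * h y)"
  shows "expected_hitting_time M X g < \<infinity>"
    and "complex_of_real (enn2real (expected_hitting_time M X g)) = h x0"
proof -
  interpret prob_space M using mc by (simp add: markov_chain_def)
  have X: "X s \<in> measurable M (count_space S)" for s
    using mc by (simp add: markov_chain_def)
  have XS: "X s \<omega> \<in> S" if "\<omega> \<in> space M" for s \<omega>
    using measurable_space[OF X that] by simp
  note [measurable] = markov_chain_pred_state[OF mc]
  define A where "A t = {\<omega> \<in> space M. \<forall>s\<le>t. X s \<omega> \<noteq> g}" for t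
  define m where "m t x = measure M {\<omega> \<in> space M. (\<forall>s\<le>t. X s \<omega> \<noteq> g) \<and> X t \<omega> = x}" for t x
  define q where "q t = measure M (A t)" for t
  define a where "a t = (\<Sum>x\<in>S. complex_of_real (m t x) * h x)" for t
  have [measurable]: "A t \<in> sets M" for t unfolding A_def by measurable
  have mg: "m t g = 0" for t unfolding m_def by (auto intro!: arg_cong[where f="measure M" and y="{}", simplified])
  have part: "measure M {\<omega> \<in> space M. \<omega> \<in> B} = (\<Sum>x\<in>S. measure M {\<omega> \<in> space M. \<omega> \<in> B \<and> X t \<omega> = x})"
    if [measurable]: "B \<in> sets M" for B t
  proof -
    have "{\<omega> \<in> space M. \<omega> \<in> B} = (\<Union>x\<in>S. {\<omega> \<in> space M. \<omega> \<in> B \<and> X t \<omega> = x})"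
      using XS by auto
    also have "measure M \<dots> = (\<Sum>x\<in>S. measure M {\<omega> \<in> space M. \<omega> \<in> B \<and> X t \<omega> = x})"
      using S by (intro finite_measure_finite_Union) (auto simp: disjoint_family_on_def)
    finally show ?thesis .
  qed
  have q: "q t = (\<Sum>x\<in>S. m t x)" for t
    using part[of "A t" t] by (simp add: q_def m_def A_def cong: conj_cong)
  have m_nonneg: "m t x \<ge> 0" for t x by (simp add: m_def)
  have m_Suc: "m (Suc t) y = (\<Sum>x\<in>S. P x y * m t x)" if y: "y \<in> S" "y \<noteq> g" for t y
  proof -
    have "m (Suc t) y = measure M {\<omega> \<in> space M. \<omega> \<in> A t \<inter> {\<omega> \<in> space M. X (Suc t) \<omega> = y}}"
      using y by (auto simp: m_def A_def le_Suc_eq intro!: arg_cong[where f="measure M"])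
    also have "\<dots> = (\<Sum>x\<in>S. measure M {\<omega> \<in> space M. \<omega> \<in> A t \<inter> {\<omega> \<in> space M. X (Suc t) \<omega> = y} \<and> X t \<omega> = x})"
      by (rule part) measurable
    also have "\<dots> = (\<Sum>x\<in>S. measure M {\<omega> \<in> space M. (\<forall>s\<le>t. X s \<omega> \<in> - {g}) \<and> X t \<omega> = x \<and> X (Suc t) \<omega> = y})"
      by (auto simp: A_def intro!: sum.cong arg_cong[where f="measure M"])
    also have "\<dots> = (\<Sum>x\<in>S. P x y * m t x)"
      by (subst markov_chain_step_avoiding[OF mc S y(1)]) (simp add: m_def)
    finally show ?thesis .
  qed
  \<comment> \<open>On the event that \<open>g\<close> is hit exactly at time \<open>t + 1\<close>, the factor \<open>h g = 0\<close> removes the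
    contribution, so the step can be taken as if the chain were not stopped.\<close>
  have a_Suc: "a (Suc t) = a t - complex_of_real (q t)" for t
  proof -
    have "a (Suc t) = (\<Sum>y\<in>S. (\<Sum>x\<in>S. complex_of_real (P x y * m t x)) * h y)"
      unfolding a_def
    proof (rule sum.cong)
      fix y assume "y \<in> S"
      then show "complex_of_real (m (Suc t) y) * h y =
          (\<Sum>x\<in>S. complex_of_real (P x y * m t x)) * h y"
        using hg by (cases "y = g") (simp_all add: m_Suc)
    qed simp
    also have "\<dots> = (\<Sum>y\<in>S. \<Sum>x\<in>S. complex_of_real (m t x) * (complex_of_real (P x y) * h y))"
      by (simp add: sum_distrib_left sum_distrib_right mult_ac)
    also have "\<dots> = (\<Sum>x\<in>S. complex_of_real (m t x) * (\<Sum>y\<in>S. complex_of_real (P x y) * h y))"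
      by (subst sum.swap) (simp add: sum_distrib_left)
    also have "\<dots> = (\<Sum>x\<in>S. complex_of_real (m t x) * (h x - 1))"
    proof (rule sum.cong)
      fix x assume "x \<in> S"
      then show "complex_of_real (m t x) * (\<Sum>y\<in>S. complex_of_real (P x y) * h y) =
          complex_of_real (m t x) * (h x - 1)"
        using h[of x] mg by (cases "x = g") auto
    qed simp
    also have "\<dots> = a t - complex_of_real (q t)"
      by (simp add: a_def q algebra_simps sum_subtractf)
    finally show ?thesis .
  qed
  have start: "AE \<omega> in M. X 0 \<omega> = x0" using mc by (simp add: markov_chain_def)
  have x0: "x0 \<in> S"
  proof (rule ccontr)
    assume "x0 \<notin> S"
    then have "AE \<omega> in M. False"
      by (intro AE_mp[OF start AE_I2]) (use XS in blast)
    then show False by simp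
  qed
  have m_0: "m 0 x = (if x = x0 \<and> x0 \<noteq> g then 1 else 0)" for x
  proof -
    have "m 0 x = measure M {\<omega> \<in> space M. x = x0 \<and> x0 \<noteq> g}"
      unfolding m_def using start by (intro finite_measure_eq_AE) auto
    then show ?thesis by (auto simp: prob_space)
  qed
  \<comment> \<open>For \<open>x0 = g\<close> the event is null and \<open>h g = 0\<close> makes the two sides agree.\<close>
  have a_0: "a 0 = h x0"
    using x0 S hg by (cases "x0 = g") (simp_all add: a_def m_0 if_distrib if_distribR cong: if_cong)
  have a_sum: "(\<Sum>s<t. complex_of_real (q s)) = h x0 - a t" for t
    by (induction t) (simp_all add: a_0 a_Suc)
  define B where "B = (\<Sum>x\<in>S. norm (h x))"
  have a_le: "norm (a t) \<le> B * q t" for t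
  proof -
    have "norm (a t) \<le> (\<Sum>x\<in>S. m t x * norm (h x))"
      unfolding a_def by (rule order_trans[OF norm_sum]) (simp add: norm_mult m_nonneg)
    also have "\<dots> \<le> (\<Sum>x\<in>S. q t * norm (h x))"
      unfolding q using m_nonneg S by (intro sum_mono mult_right_mono member_le_sum) auto
    finally show ?thesis by (simp add: B_def sum_distrib_left mult.commute)
  qed
  have q01: "0 \<le> q t" "q t \<le> 1" for t by (auto simp: q_def)
  have B0: "B \<ge> 0" by (simp add: B_def sum_nonneg)
  have "summable q"
  proof (rule summableI_nonneg_bounded[where x = "norm (h x0) + B"])
    fix n
    have "(\<Sum>s<n. q s) = norm (\<Sum>s<n. complex_of_real (q s))"
      using q01 by (simp flip: of_real_sum add: sum_nonneg)
    also have "\<dots> \<le> norm (h x0) + norm (a n)"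
      unfolding a_sum by (rule norm_triangle_ineq4)
    also have "norm (a n) \<le> B"
      using a_le[of n] mult_left_mono[OF q01(2)[of n] B0] by simp
    finally show "(\<Sum>s<n. q s) \<le> norm (h x0) + B" by simp
  qed (rule q01)
  then have "q \<longlonglongrightarrow> 0" by (rule summable_LIMSEQ_zero)
  then have "(\<lambda>t. B * q t) \<longlonglongrightarrow> 0" using tendsto_mult_right_zero by blast
  then have "a \<longlonglongrightarrow> 0"
    by (rule Lim_null_comparison[rotated]) (simp add: a_le)
  then have "(\<lambda>t. h x0 - a t) \<longlonglongrightarrow> h x0" by (auto intro!: tendsto_eq_intros)
  then have "(\<lambda>s. complex_of_real (q s)) sums h x0"
    by (simp add: sums_def a_sum)
  moreover have "(\<lambda>s. complex_of_real (q s)) sums complex_of_real (suminf q)"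
    using \<open>summable q\<close> by (simp add: sums_of_real summable_sums)
  ultimately have hx0: "complex_of_real (suminf q) = h x0" by (rule sums_unique2[symmetric])
  have less: "enat t < hitting_time X g \<omega> \<longleftrightarrow> (\<forall>s\<le>t. X s \<omega> \<noteq> g)" for t \<omega>
  proof
    assume "enat t < hitting_time X g \<omega>"
    then show "\<forall>s\<le>t. X s \<omega> \<noteq> g"
      unfolding hitting_time_def by (auto dest!: less_INF_D)
  next
    assume "\<forall>s\<le>t. X s \<omega> \<noteq> g"
    then have "enat (Suc t) \<le> hitting_time X g \<omega>"
      unfolding hitting_time_def by (intro INF_greatest) (auto simp: not_less_eq_eq[symmetric])
    then show "enat t < hitting_time X g \<omega>" by (simp add: Suc_ile_eq)
  qed
  have meas: "hitting_time X g \<in> measurable M (count_space UNIV)"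
  proof -
    have "hitting_time X g = (\<lambda>\<omega>. INF t. if X t \<omega> = g then enat t else \<infinity>)"
    proof
      fix \<omega>
      show "hitting_time X g \<omega> = (INF t. if X t \<omega> = g then enat t else \<infinity>)"
        unfolding hitting_time_def
      proof (rule antisym)
        show "(INF t\<in>{t. X t \<omega> = g}. enat t) \<le> (INF t. if X t \<omega> = g then enat t else \<infinity>)"
          by (intro INF_greatest) (simp add: INF_lower)
        show "(INF t. if X t \<omega> = g then enat t else \<infinity>) \<le> (INF t\<in>{t. X t \<omega> = g}. enat t)"
        proof (rule INF_greatest)
          fix t assume "t \<in> {t. X t \<omega> = g}"
          then show "(INF t. if X t \<omega> = g then enat t else \<infinity>) \<le> enat t"
            by (intro INF_lower2[of t]) simp_all
        qed
      qed
    qed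
    also have "\<dots> \<in> measurable M (count_space UNIV)"
      by measurable
    finally show ?thesis .
  qed
  have "expected_hitting_time M X g = (\<Sum>t. emeasure M (A t))"
    unfolding expected_hitting_time_def nn_integral_enat_function[OF meas]
    by (simp add: less A_def)
  also have "\<dots> = (\<Sum>t. ennreal (q t))" by (simp add: q_def emeasure_eq_measure)
  also have "\<dots> = ennreal (suminf q)"
    using \<open>summable q\<close> q01 by (intro suminf_ennreal2) auto
  finally have E: "expected_hitting_time M X g = ennreal (suminf q)" .
  show "expected_hitting_time M X g < \<infinity>" by (simp add: E)
  show "complex_of_real (enn2real (expected_hitting_time M X g)) = h x0"
    using suminf_nonneg[OF \<open>summable q\<close>] q01 by (simp add: E hx0)
qed

section \<open>Characters of finite abelian groups\<close>

text \<open>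
  A homomorphism into the multiplicative group of the complex numbers, with values outside the
  carrier left arbitrary; equality of characters is therefore always stated on the carrier.
\<close>

definition group_character :: "('a, 'b) monoid_scheme \<Rightarrow> ('a \<Rightarrow> complex) \<Rightarrow> bool" where
  "group_character G \<psi> \<longleftrightarrow>
     (\<forall>x\<in>carrier G. \<psi> x \<noteq> 0) \<and>
     (\<forall>x\<in>carrier G. \<forall>y\<in>carrier G. \<psi> (x \<otimes>\<^bsub>G\<^esub> y) = \<psi> x * \<psi> y)"

context group
begin

lemma group_character_one: "group_character G \<psi> \<Longrightarrow> \<psi> \<one> = 1"
  unfolding group_character_def by (metis mult_cancel_left2 one_closed r_one)

lemma group_character_pow:
  "group_character G \<psi> \<Longrightarrow> x \<in> carrier G \<Longrightarrow> \<psi> (x [^] (n::nat)) = \<psi> x ^ n"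
  by (induction n) (simp_all add: group_character_one, simp add: group_character_def mult.commute)

lemma norm_group_character:
  assumes "group_character G \<psi>" "finite (carrier G)" "x \<in> carrier G"
  shows "norm (\<psi> x) = 1"
proof -
  have "\<psi> x ^ ord x = 1"
    using assms by (simp add: group_character_one flip: group_character_pow)
  moreover have "ord x \<noteq> 0"
    using assms ord_ge_1[of x] by simp
  ultimately show ?thesis
    by (metis power_eq_1_iff)
qed

end

text \<open>
  Up to the factor \<open>1 / ord s\<close> this is the projection of \<open>f\<close> onto the eigenspace of the translation
  \<open>f \<mapsto> (\<lambda>x. f (x \<otimes> s))\<close> for the eigenvalue \<open>inverse \<zeta>\<close>, where \<open>\<zeta>\<close> is a root of unity of order
  dividing \<open>ord s\<close>.
\<close>

definition translation_eigenpart ::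
  "('a, 'b) monoid_scheme \<Rightarrow> 'a \<Rightarrow> complex \<Rightarrow> ('a \<Rightarrow> complex) \<Rightarrow> 'a \<Rightarrow> complex" where
  "translation_eigenpart G s \<zeta> f x = (\<Sum>j<group.ord G s. \<zeta> ^ j * f (x \<otimes>\<^bsub>G\<^esub> s [^]\<^bsub>G\<^esub> j))"

context comm_group
begin

text \<open>
  Translating by \<open>s\<close> shifts the summation index by one; the sum is cyclic because
  \<open>\<zeta> ^ ord s = 1\<close> and \<open>s [^] ord s = \<one>\<close>.
\<close>

lemma translation_eigenpart_translate:
  assumes "\<zeta> ^ ord s = 1" "s \<in> carrier G" "x \<in> carrier G"
  shows "translation_eigenpart G s \<zeta> f (x \<otimes> s) = inverse \<zeta> * translation_eigenpart G s \<zeta> f x"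
proof (cases "ord s = 0")
  case False
  define u where "u j = \<zeta> ^ j * f (x \<otimes> s [^] j)" for j :: nat
  have "\<zeta> * translation_eigenpart G s \<zeta> f (x \<otimes> s) = (\<Sum>j<ord s. u (Suc j))"
    using assms
    by (simp add: translation_eigenpart_def sum_distrib_left u_def m_assoc m_comm[of s] mult.assoc)
  also have "\<dots> = (\<Sum>j<ord s. u j) + u (ord s) - u 0"
    using sum.lessThan_Suc_shift[of u "ord s"] by simp
  also have "u (ord s) = u 0"
    using assms by (simp add: u_def)
  also have "(\<Sum>j<ord s. u j) = translation_eigenpart G s \<zeta> f x"
    by (simp add: u_def translation_eigenpart_def)
  finally show ?thesis
    using assms(1) False by (cases "\<zeta> = 0") (auto simp: field_simps power_0_left)
qed (simp add: translation_eigenpart_def)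

text \<open>
  Translations of an abelian group commute, so projecting for \<open>s\<close> keeps an eigenvalue already
  obtained for \<open>t\<close>. This allows the elements of the group to be treated one after the other.
\<close>

lemma translation_eigenpart_preserves:
  assumes f: "\<And>x. x \<in> carrier G \<Longrightarrow> f (x \<otimes> t) = c * f x"
    and "s \<in> carrier G" "t \<in> carrier G" "x \<in> carrier G"
  shows "translation_eigenpart G s \<zeta> f (x \<otimes> t) = c * translation_eigenpart G s \<zeta> f x"
proof -
  have "f (x \<otimes> t \<otimes> s [^] j) = c * f (x \<otimes> s [^] j)" for j :: nat
    using f[of "x \<otimes> s [^] j"] assms(2-) by (simp add: m_ac)
  then show ?thesis
    by (simp add: translation_eigenpart_def sum_distrib_left mult_ac)
qed

text \<open>
  The eigenparts for all the \<open>ord s\<close>-th roots of unity add up to \<open>ord s\<close> times \<open>f\<close>, so at a point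
  where \<open>f\<close> does not vanish one of them does not vanish either.
\<close>

lemma translation_eigenpart_nonzero:
  assumes s: "s \<in> carrier G" and m: "ord s > 0" and x: "x \<in> carrier G" "f x \<noteq> 0"
  obtains \<zeta> where "\<zeta> ^ ord s = 1" "translation_eigenpart G s \<zeta> f x \<noteq> 0"
proof -
  define m where "m = ord s"
  define \<epsilon> where "\<epsilon> = cis (2 * pi / m)"
  have "m > 0" using m by (simp add: m_def)
  have \<epsilon>m: "\<epsilon> ^ m = 1"
    using \<open>m > 0\<close> Complex.DeMoivre[of "2 * pi / m" m] by (simp add: \<epsilon>_def)
  have \<epsilon>1: "\<epsilon> ^ j \<noteq> 1" if "0 < j" "j < m" for j
  proof
    assume "\<epsilon> ^ j = 1"
    then have "cis (2 * pi * (real j / real m)) = 1"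
      by (simp add: \<epsilon>_def Complex.DeMoivre field_simps)
    then have "cos (2 * pi * (real j / real m)) = 1"
      by (simp add: complex_eq_iff)
    then obtain k :: int where "2 * pi * (real j / real m) = of_int k * 2 * pi"
      by (auto simp: cos_one_2pi_int)
    then have "real j = of_int k * real m"
      using \<open>m > 0\<close> by (simp add: field_simps)
    then have "int j = k * int m"
      by (metis of_int_eq_iff of_int_mult of_int_of_nat_eq)
    then show False
      using that by (metis dvd_triv_right int_dvd_int_iff nat_dvd_not_less)
  qed
  have geo: "(\<Sum>k<m. (\<epsilon> ^ j) ^ k) = (if j = 0 then of_nat m else 0)" if "j < m" for j
  proof (cases "j = 0")
    case False
    have "(\<epsilon> ^ j) ^ m = 1"
      by (metis \<epsilon>m power_mult mult.commute power_one)
    then show ?thesis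
      using False that \<epsilon>1[of j] by (simp add: geometric_sum)
  qed simp
  have "(\<Sum>k<m. translation_eigenpart G s (\<epsilon> ^ k) f x) =
      (\<Sum>j<m. (\<Sum>k<m. (\<epsilon> ^ j) ^ k) * f (x \<otimes> s [^] j))"
    unfolding translation_eigenpart_def m_def[symmetric]
    by (subst sum.swap) (simp add: sum_distrib_left sum_distrib_right mult.commute flip: power_mult)
  also have "\<dots> = (\<Sum>j<m. if j = 0 then of_nat m * f (x \<otimes> s [^] j) else 0)"
    by (intro sum.cong) (auto simp: geo)
  also have "\<dots> = of_nat m * f x"
    using \<open>m > 0\<close> x by simp
  also have "\<dots> \<noteq> 0"
    using \<open>m > 0\<close> x by simp
  finally obtain k where "translation_eigenpart G s (\<epsilon> ^ k) f x \<noteq> 0"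
    by (metis (no_types, lifting) sum.neutral)
  moreover have "(\<epsilon> ^ k) ^ ord s = 1"
    by (metis \<epsilon>m m_def power_mult mult.commute power_one)
  ultimately show thesis using that by blast
qed

text \<open>
  Start from an eigenfunction of the translation by \<open>g\<close> with an eigenvalue other than \<open>1\<close>, namely
  the eigenpart of the indicator function of \<open>\<one>\<close> for a primitive root of unity, and refine it by
  further projections until it is an eigenfunction of every translation. The eigenvalue of the
  translation by \<open>t\<close>, as a function of \<open>t\<close>, is a character whose value at \<open>g\<close> is the initial
  eigenvalue.
\<close>

lemma group_character_separates:
  assumes fin: "finite (carrier G)" and g: "g \<in> carrier G" "g \<noteq> \<one>"
  obtains \<psi> where "group_character G \<psi>" "\<psi> g \<noteq> 1"
proof -
  have ord_pos: "ord s > 0" if "s \<in> carrier G" for s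
    using ord_ge_1[OF fin that] by simp
  have "\<exists>f. (\<exists>x\<in>carrier G. f x \<noteq> 0) \<and> (\<exists>c. c \<noteq> 1 \<and> (\<forall>x\<in>carrier G. f (x \<otimes> g) = c * f x)) \<and>
      (\<forall>s\<in>S. \<exists>c. \<forall>x\<in>carrier G. f (x \<otimes> s) = c * (f x :: complex))"
    if "finite S" "S \<subseteq> carrier G" for S
    using that
  proof (induction S rule: finite_induct)
    case empty
    define \<zeta> where "\<zeta> = cis (2 * pi / ord g)"
    define f where "f = translation_eigenpart G g \<zeta> (\<lambda>x. if x = \<one> then 1 else 0)"
    have "ord g \<noteq> 1" using g ord_eq_1 by blast
    then have "ord g > 1" using ord_pos[OF g(1)] by linarith
    then have "\<zeta> \<noteq> 1"
    proof -
      have "0 < 2 * pi / ord g" "2 * pi / ord g \<le> pi"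
        using \<open>ord g > 1\<close> by (auto simp: field_simps)
      then have "cos (2 * pi / ord g) \<noteq> 1"
        using cos_monotone_0_pi[of 0 "2 * pi / ord g"] by simp
      then show ?thesis by (auto simp: \<zeta>_def complex_eq_iff)
    qed
    have "\<zeta> ^ ord g = 1"
      using ord_pos[OF g(1)] Complex.DeMoivre[of "2 * pi / ord g" "ord g"] by (simp add: \<zeta>_def)
    then have "f (x \<otimes> g) = inverse \<zeta> * f x" if "x \<in> carrier G" for x
      unfolding f_def using translation_eigenpart_translate g that by blast
    \<comment> \<open>Among the powers \<open>g [^] j\<close> with \<open>j < ord g\<close> only \<open>j = 0\<close> gives \<open>\<one>\<close>.\<close>
    moreover have "f \<one> = (\<Sum>j<ord g. if j = 0 then 1 else 0)"
      unfolding f_def translation_eigenpart_def using g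
      by (intro sum.cong) (auto simp: pow_eq_id dest: dvd_imp_le)
    then have "f \<one> = 1"
      using ord_pos[OF g(1)] by simp
    moreover have "inverse \<zeta> \<noteq> 1" using \<open>\<zeta> \<noteq> 1\<close> by simp
    ultimately show ?case
      by (metis empty_iff one_closed zero_neq_one)
  next
    case (insert s S)
    then obtain f x c where f: "x \<in> carrier G" "f x \<noteq> 0" "c \<noteq> 1"
        "\<And>x. x \<in> carrier G \<Longrightarrow> f (x \<otimes> g) = c * f x"
        "\<And>t. t \<in> S \<Longrightarrow> \<exists>c. \<forall>x\<in>carrier G. f (x \<otimes> t) = c * (f x :: complex)"
      by auto
    have s: "s \<in> carrier G" "S \<subseteq> carrier G" using insert.prems by auto
    obtain \<zeta> where \<zeta>: "\<zeta> ^ ord s = 1" "translation_eigenpart G s \<zeta> f x \<noteq> 0"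
      using translation_eigenpart_nonzero[of s x f] s ord_pos f(1,2) by blast
    define f' where "f' = translation_eigenpart G s \<zeta> f"
    have "\<forall>x\<in>carrier G. f' (x \<otimes> g) = c * f' x"
      unfolding f'_def using translation_eigenpart_preserves[of f g c s] f(4) s g by blast
    moreover have "\<forall>x\<in>carrier G. f' (x \<otimes> s) = inverse \<zeta> * f' x"
      unfolding f'_def using translation_eigenpart_translate \<zeta>(1) s by blast
    moreover have "\<exists>c. \<forall>x\<in>carrier G. f' (x \<otimes> t) = c * f' x" if t: "t \<in> S" for t
    proof -
      obtain d where "\<forall>x\<in>carrier G. f (x \<otimes> t) = d * f x"
        using f(5)[OF t] by blast
      then have "\<forall>x\<in>carrier G. f' (x \<otimes> t) = d * f' x"
        unfolding f'_def using translation_eigenpart_preserves[of f t d s] s t by blast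
      then show ?thesis by blast
    qed
    ultimately show ?case
      using f(1,3) \<zeta>(2) unfolding f'_def[symmetric] by blast
  qed
  from this[OF fin] obtain f x0 c where f: "x0 \<in> carrier G" "f x0 \<noteq> 0" "c \<noteq> 1"
      "\<And>x. x \<in> carrier G \<Longrightarrow> f (x \<otimes> g) = c * f x"
      "\<And>t. t \<in> carrier G \<Longrightarrow> \<exists>c. \<forall>x\<in>carrier G. f (x \<otimes> t) = c * (f x :: complex)"
    by auto
  define \<psi> where "\<psi> t = f (x0 \<otimes> t) / f x0" for t
  have \<psi>: "f (x \<otimes> t) = \<psi> t * f x" if xt: "x \<in> carrier G" "t \<in> carrier G" for x t
  proof -
    obtain d where d: "\<forall>x\<in>carrier G. f (x \<otimes> t) = d * f x"
      using f(5)[OF xt(2)] by blast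
    then have "\<psi> t = d" using f(1,2) by (simp add: \<psi>_def)
    then show ?thesis using d xt by simp
  qed
  have mult: "\<psi> (x \<otimes> y) = \<psi> x * \<psi> y" if "x \<in> carrier G" "y \<in> carrier G" for x y
  proof -
    have "\<psi> (x \<otimes> y) * f x0 = f (x0 \<otimes> x \<otimes> y)"
      using \<psi>[of x0 "x \<otimes> y"] that f(1) by (simp add: m_assoc)
    also have "\<dots> = \<psi> y * f (x0 \<otimes> x)"
      using \<psi>[of "x0 \<otimes> x" y] that f(1) by simp
    also have "f (x0 \<otimes> x) = \<psi> x * f x0"
      using \<psi>[of x0 x] that f(1) by simp
    finally show ?thesis using f(2) by simp
  qed
  have one: "\<psi> \<one> = 1" using f(1,2) by (simp add: \<psi>_def)
  have "\<psi> x \<noteq> 0" if "x \<in> carrier G" for x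
    using mult[of x "inv x"] one that by auto
  then have "group_character G \<psi>"
    using mult by (simp add: group_character_def)
  moreover have "\<psi> g \<noteq> 1"
    using f(1-4) by (simp add: \<psi>_def)
  ultimately show thesis using that by blast
qed

text \<open>
  Multiplication by a fixed character \<open>\<phi>\<close> permutes the set of all characters, so the sum is
  unchanged when multiplied by \<open>\<phi> g\<close>; choosing \<open>\<phi>\<close> with \<open>\<phi> g \<noteq> 1\<close> makes it vanish.
\<close>

lemma sum_all_characters_eq_0:
  assumes fin: "finite (carrier G)" "finite I" and g: "g \<in> carrier G" "g \<noteq> \<one>"
    and char: "\<And>i. i \<in> I \<Longrightarrow> group_character G (\<psi> i)"
    and ex1: "\<And>\<phi>. group_character G \<phi> \<Longrightarrow> \<exists>!i. i \<in> I \<and> (\<forall>x\<in>carrier G. \<phi> x = \<psi> i x)"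
  shows "(\<Sum>i\<in>I. \<psi> i g) = 0"
proof -
  obtain \<phi> where \<phi>: "group_character G \<phi>" "\<phi> g \<noteq> 1"
    using group_character_separates[OF fin(1) g] by blast
  have "\<exists>j. j \<in> I \<and> (\<forall>x\<in>carrier G. \<phi> x * \<psi> i x = \<psi> j x)" if "i \<in> I" for i
  proof -
    have "group_character G (\<lambda>x. \<phi> x * \<psi> i x)"
      using \<phi>(1) char[OF that] by (simp add: group_character_def)
    then show ?thesis using ex1 by blast
  qed
  then obtain \<pi> where \<pi>: "\<And>i. i \<in> I \<Longrightarrow> \<pi> i \<in> I"
      "\<And>i x. i \<in> I \<Longrightarrow> x \<in> carrier G \<Longrightarrow> \<phi> x * \<psi> i x = \<psi> (\<pi> i) x"
    by metis
  have "inj_on \<pi> I"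
  proof
    fix i j assume ij: "i \<in> I" "j \<in> I" "\<pi> i = \<pi> j"
    have "\<psi> i x = \<psi> j x" if "x \<in> carrier G" for x
      using \<pi>(2)[OF ij(1) that] \<pi>(2)[OF ij(2) that] ij(3) \<phi>(1) that
      by (metis group_character_def mult_cancel_left)
    then show "i = j"
      using ex1[OF char[OF ij(1)]] ij(1,2) by metis
  qed
  then have "bij_betw \<pi> I I"
    using \<pi>(1) fin(2) by (simp add: bij_betw_def endo_inj_surj image_subsetI)
  then have "(\<Sum>i\<in>I. \<psi> i g) = (\<Sum>i\<in>I. \<psi> (\<pi> i) g)"
    by (rule sum.reindex_bij_betw[symmetric])
  also have "\<dots> = \<phi> g * (\<Sum>i\<in>I. \<psi> i g)"
    using \<pi>(2) g by (simp add: sum_distrib_left)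
  finally show ?thesis using \<phi>(2) by simp
qed

end

text \<open>
  An average of numbers of modulus \<open>1\<close> equals \<open>1\<close> only if all those of positive weight are \<open>1\<close>.
  Hence \<open>\<psi>\<close> is \<open>1\<close> on the support of \<open>p\<close> and does not change along a step of the walk, and by
  irreducibility the walk leads from any element to any other.
\<close>

lemma (in group) walk_fourier_eq_1_imp_trivial:
  assumes fin: "finite (carrier G)" and p: "set_pmf p \<subseteq> carrier G"
    and irr: "irreducible_kernel (carrier G) (walk_kernel G p)"
    and \<psi>: "group_character G \<psi>"
    and eq: "(\<Sum>s\<in>carrier G. complex_of_real (pmf p s) * \<psi> s) = 1"
    and x: "x \<in> carrier G"
  shows "\<psi> x = 1"
proof -
  have norm: "norm (\<psi> s) = 1" if "s \<in> carrier G" for s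
    using norm_group_character \<psi> fin that by blast
  have "(\<Sum>s\<in>carrier G. pmf p s * Re (\<psi> s)) = 1"
    using arg_cong[OF eq, of Re] by simp
  then have "(\<Sum>s\<in>carrier G. pmf p s * (1 - Re (\<psi> s))) = 0"
    using sum_pmf_eq_1[OF fin p] by (simp add: algebra_simps sum_subtractf)
  moreover have "pmf p s * (1 - Re (\<psi> s)) \<ge> 0" if "s \<in> carrier G" for s
    using norm[OF that] complex_Re_le_cmod[of "\<psi> s"] by simp
  ultimately have zero: "\<forall>s\<in>carrier G. pmf p s * (1 - Re (\<psi> s)) = 0"
    by (subst (asm) sum_nonneg_eq_0_iff[OF fin]) auto
  then have supp: "\<psi> s = 1" if "s \<in> carrier G" "pmf p s \<noteq> 0" for s
    using norm[OF that(1)] zero that cmod_power2[of "\<psi> s"]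
    by (force simp: complex_eq_iff)
  have step: "\<psi> z = \<psi> y" if "kernel_power (carrier G) (walk_kernel G p) t y z > 0"
      "y \<in> carrier G" "z \<in> carrier G" for t y z
    using that
  proof (induction t arbitrary: y)
    case (Suc t)
    have "(\<Sum>w\<in>carrier G. walk_kernel G p y w * kernel_power (carrier G) (walk_kernel G p) t w z) > 0"
      using Suc.prems by simp
    then obtain w where w: "w \<in> carrier G"
        "walk_kernel G p y w * kernel_power (carrier G) (walk_kernel G p) t w z > 0"
      by (meson not_le sum_nonpos)
    then have pos: "pmf p (w \<otimes> inv y) > 0" "kernel_power (carrier G) (walk_kernel G p) t w z > 0"
      using pmf_nonneg[of p "w \<otimes> inv y"] by (auto simp: walk_kernel_def zero_less_mult_iff)
    have "\<psi> w = \<psi> (w \<otimes> inv y \<otimes> y)"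
      using w(1) Suc.prems by (simp add: m_assoc)
    also have "\<dots> = \<psi> (w \<otimes> inv y) * \<psi> y"
      using \<psi> w(1) Suc.prems by (simp add: group_character_def)
    also have "\<psi> (w \<otimes> inv y) = 1"
      using supp[of "w \<otimes> inv y"] pos w(1) Suc.prems by simp
    finally show ?case
      using Suc.IH[OF pos(2) w(1)] Suc.prems by simp
  qed (simp split: if_splits)
  have "\<psi> x = \<psi> \<one>"
    using irr step x unfolding irreducible_kernel_def by (meson one_closed)
  then show ?thesis
    using \<psi> by (simp add: group_character_one)
qed

section \<open>Irreducible representations of abelian groups\<close>

(* Below, $ selects an entry of a vector of variable dimension. *)
unbundle no vec_syntax

lemma representation_carrier:
  assumes "representation G n \<rho>" "g \<in> carrier G"
  shows "\<rho> g \<in> carrier_mat n n"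
  using assms
  by (auto simp: representation_def general_linear_def hom_def units_of_carrier Units_def ring_mat_simps)

lemma representation_mult:
  assumes "representation G n \<rho>" "g \<in> carrier G" "h \<in> carrier G"
  shows "\<rho> (g \<otimes>\<^bsub>G\<^esub> h) = \<rho> g * \<rho> h"
  using assms
  by (auto simp: representation_def general_linear_def hom_def units_of_mult ring_mat_simps)

lemma subspace_vecI:
  fixes W :: "complex vec set"
  assumes "W \<subseteq> carrier_vec n" "0\<^sub>v n \<in> W" "\<And>v w. v \<in> W \<Longrightarrow> w \<in> W \<Longrightarrow> v + w \<in> W"
    "\<And>c v. v \<in> W \<Longrightarrow> c \<cdot>\<^sub>v v \<in> W"
  shows "subspace class_ring W (module_vec TYPE(complex) n)"
  unfolding subspace_def submodule_def
  using assms vec_vs vec_module by (auto simp: module_vec_simps)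

text \<open>
  Schur's lemma for a single matrix: an eigenspace of \<open>\<rho> g\<close> is mapped into itself by every
  matrix that commutes with \<open>\<rho> g\<close>, hence is invariant, and being nonzero it is the whole space.
\<close>

lemma (in comm_group) irreducible_rep_scalar:
  assumes irr: "irreducible_rep G n \<rho>" and g: "g \<in> carrier G"
  obtains c where "\<And>v. v \<in> carrier_vec n \<Longrightarrow> \<rho> g *\<^sub>v v = c \<cdot>\<^sub>v v"
proof -
  have n: "n > 0" and rep: "representation G n \<rho>"
    and W: "\<And>W. invariant_subspace G n \<rho> W \<Longrightarrow> W = {0\<^sub>v n} \<or> W = carrier_vec n"
    using irr by (auto simp: irreducible_rep_def)
  note car = representation_carrier[OF rep]
  obtain c where "eigenvalue (\<rho> g) c"
    using spectrum_non_empty[OF car[OF g] n] by (auto simp: spectrum_def)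
  then obtain v where v: "v \<in> carrier_vec n" "v \<noteq> 0\<^sub>v n" "\<rho> g *\<^sub>v v = c \<cdot>\<^sub>v v"
    using car[OF g] by (auto simp: eigenvalue_def eigenvector_def)
  define E where "E = {v \<in> carrier_vec n. \<rho> g *\<^sub>v v = c \<cdot>\<^sub>v v}"
  have "invariant_subspace G n \<rho> E"
    unfolding invariant_subspace_def
  proof (intro conjI ballI subspace_vecI)
    fix h v assume h: "h \<in> carrier G" and "v \<in> E"
    then have v: "v \<in> carrier_vec n" "\<rho> g *\<^sub>v v = c \<cdot>\<^sub>v v"
      by (auto simp: E_def)
    have "\<rho> g *\<^sub>v (\<rho> h *\<^sub>v v) = \<rho> (g \<otimes> h) *\<^sub>v v"
      using car g h v(1) by (simp add: representation_mult[OF rep] assoc_mult_mat_vec[of _ n n _ n])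
    also have "\<dots> = \<rho> h *\<^sub>v (\<rho> g *\<^sub>v v)"
      using car g h v(1)
      by (simp add: representation_mult[OF rep] m_comm[of g h] assoc_mult_mat_vec[of _ n n _ n])
    also have "\<dots> = c \<cdot>\<^sub>v (\<rho> h *\<^sub>v v)"
      using car[OF h] v by (simp add: mult_mat_vec[of _ n n])
    finally show "\<rho> h *\<^sub>v v \<in> E"
      using mult_mat_vec_carrier[OF car[OF h] v(1)] by (simp add: E_def)
  qed (use car[OF g] in \<open>auto simp: E_def mult_add_distrib_mat_vec[of _ n n] smult_add_distrib_vec[of _ n]
        mult_mat_vec[of _ n n] smult_smult_assoc mult.commute\<close>)
  moreover have "v \<in> E" using v by (simp add: E_def)
  ultimately have "E = carrier_vec n" using W v(2) by blast
  then show thesis using that by (auto simp: E_def)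
qed

text \<open>
  Since every \<open>\<rho> g\<close> is a scalar, every subspace is invariant; in degree above \<open>1\<close> the line spanned
  by the first unit vector is proper.
\<close>

lemma (in comm_group) irreducible_rep_degree:
  assumes irr: "irreducible_rep G n \<rho>"
  shows "n = 1"
proof (rule ccontr)
  assume "n \<noteq> 1"
  then have n: "n > 1" using irr by (simp add: irreducible_rep_def)
  have rep: "representation G n \<rho>"
    and W: "\<And>W. invariant_subspace G n \<rho> W \<Longrightarrow> W = {0\<^sub>v n} \<or> W = carrier_vec n"
    using irr by (auto simp: irreducible_rep_def)
  define L where "L = {v \<in> carrier_vec n. \<forall>i<n. i \<noteq> 0 \<longrightarrow> v $ i = (0 :: complex)}"
  have "invariant_subspace G n \<rho> L"
    unfolding invariant_subspace_def
  proof (intro conjI ballI subspace_vecI)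
    fix g v assume g: "g \<in> carrier G" and v: "v \<in> L"
    obtain c where "\<And>v. v \<in> carrier_vec n \<Longrightarrow> \<rho> g *\<^sub>v v = c \<cdot>\<^sub>v v"
      using irreducible_rep_scalar[OF irr g] by blast
    then show "\<rho> g *\<^sub>v v \<in> L" using v by (auto simp: L_def)
  qed (auto simp: L_def)
  then consider "L = {0\<^sub>v n}" | "L = carrier_vec n" using W by blast
  then show False
  proof cases
    case 1
    have "unit_vec n 0 \<in> L" by (auto simp: L_def)
    then have "unit_vec n 0 $ 0 = (0\<^sub>v n $ 0 :: complex)" using 1 by simp
    then show False using n by simp
  next
    case 2
    have "unit_vec n 1 \<in> L" using 2 by simp
    then have "unit_vec n 1 $ 1 = (0 :: complex)" using n unfolding L_def by auto
    then show False using n by simp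
  qed
qed

lemma mat_1_eqI:
  assumes "A \<in> carrier_mat 1 1" "B \<in> carrier_mat 1 1" "A $$ (0, 0) = B $$ (0, 0)"
  shows "A = B"
  using assms by (intro eq_matI) auto

lemma index_mult_mat_1:
  assumes "A \<in> carrier_mat 1 1" "B \<in> carrier_mat 1 1"
  shows "(A * B) $$ (0, 0) = A $$ (0, 0) * (B $$ (0, 0) :: complex)"
  using assms by (simp add: scalar_prod_def)

lemma character_of_rep_1:
  assumes rep: "representation G 1 \<rho>"
  shows "group_character G (\<lambda>g. \<rho> g $$ (0, 0))"
proof -
  have "\<rho> g $$ (0, 0) \<noteq> 0" if "g \<in> carrier G" for g
  proof -
    have "\<rho> g \<in> Units (ring_mat TYPE(complex) 1 ())"
      using rep that by (auto simp: representation_def general_linear_def hom_def units_of_carrier)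
    then obtain B where "B \<in> carrier_mat 1 1" "\<rho> g \<in> carrier_mat 1 1" "B * \<rho> g = 1\<^sub>m 1"
      by (auto simp: Units_def ring_mat_simps)
    then have "B $$ (0, 0) * \<rho> g $$ (0, 0) = 1"
      using index_mult_mat_1[of B "\<rho> g"] by simp
    then show ?thesis by auto
  qed
  then show ?thesis
    using representation_carrier[OF rep] representation_mult[OF rep]
    by (simp add: group_character_def index_mult_mat_1)
qed

lemma rep_1_of_character:
  assumes \<psi>: "group_character G \<psi>"
  shows "irreducible_rep G 1 (\<lambda>g. mat 1 1 (\<lambda>_. \<psi> g))"
proof -
  have "mat 1 1 (\<lambda>_. \<psi> g) \<in> Units (ring_mat TYPE(complex) 1 ())" if "g \<in> carrier G" for g
    using \<psi> that unfolding Units_def group_character_def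
    by (auto simp: ring_mat_simps scalar_prod_def intro!: bexI[of _ "mat 1 1 (\<lambda>_. inverse (\<psi> g))"] mat_1_eqI)
  moreover have "mat 1 1 (\<lambda>_. \<psi> (g \<otimes>\<^bsub>G\<^esub> h)) = mat 1 1 (\<lambda>_. \<psi> g) * mat 1 1 (\<lambda>_. \<psi> h)"
    if "g \<in> carrier G" "h \<in> carrier G" for g h
    using \<psi> that unfolding group_character_def
    by (intro mat_1_eqI) (auto simp: scalar_prod_def)
  ultimately have "representation G 1 (\<lambda>g. mat 1 1 (\<lambda>_. \<psi> g))"
    by (auto simp: representation_def general_linear_def hom_def units_of_carrier units_of_mult ring_mat_simps)
  moreover have "W = {0\<^sub>v 1} \<or> W = carrier_vec 1"
    if W: "subspace class_ring W (module_vec TYPE(complex) 1)" for W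
  proof (cases "W \<subseteq> {0\<^sub>v 1}")
    case True
    have "0\<^sub>v 1 \<in> W"
      using W by (auto simp: subspace_def submodule_def module_vec_simps)
    then show ?thesis using True by blast
  next
    case False
    then obtain v where v: "v \<in> W" "v \<noteq> 0\<^sub>v 1" by blast
    have Wc: "W \<subseteq> carrier_vec 1" and sm: "\<And>c. c \<cdot>\<^sub>v v \<in> W"
      using W v(1) by (auto simp: subspace_def submodule_def module_vec_simps)
    then have "v $ 0 \<noteq> 0" using v by (auto simp: vec_eq_iff)
    have "w \<in> W" if "w \<in> carrier_vec 1" for w
    proof -
      have "w = (w $ 0 / v $ 0) \<cdot>\<^sub>v v"
        using that v(1) Wc \<open>v $ 0 \<noteq> 0\<close> by (intro eq_vecI) auto
      then show ?thesis using sm by metis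
    qed
    then show ?thesis using Wc by blast
  qed
  ultimately show ?thesis
    by (auto simp: irreducible_rep_def invariant_subspace_def)
qed

text \<open>
  In degree \<open>1\<close> matrices commute, so an invertible intertwiner can be cancelled.
\<close>

lemma isomorphic_reps_1_iff:
  assumes "\<And>g. g \<in> carrier G \<Longrightarrow> \<rho> g \<in> carrier_mat 1 1"
    and "\<And>g. g \<in> carrier G \<Longrightarrow> \<sigma> g \<in> carrier_mat 1 1"
  shows "isomorphic_reps G 1 \<rho> 1 \<sigma> \<longleftrightarrow> (\<forall>g\<in>carrier G. \<rho> g $$ (0, 0) = \<sigma> g $$ (0, 0))"
proof
  assume "isomorphic_reps G 1 \<rho> 1 \<sigma>"
  then obtain T where "T \<in> Units (ring_mat TYPE(complex) 1 ())"
      and T: "\<And>g. g \<in> carrier G \<Longrightarrow> T * \<rho> g = \<sigma> g * T"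
    by (auto simp: isomorphic_reps_def general_linear_def units_of_carrier)
  then obtain B where B: "B \<in> carrier_mat 1 1" "T \<in> carrier_mat 1 1" "B * T = 1\<^sub>m 1"
    by (auto simp: Units_def ring_mat_simps)
  then have "B $$ (0, 0) * T $$ (0, 0) = 1"
    using index_mult_mat_1[of B T] by simp
  then have T0: "T $$ (0, 0) \<noteq> 0" by auto
  show "\<forall>g\<in>carrier G. \<rho> g $$ (0, 0) = \<sigma> g $$ (0, 0)"
  proof
    fix g assume g: "g \<in> carrier G"
    have "T $$ (0, 0) * \<rho> g $$ (0, 0) = \<sigma> g $$ (0, 0) * T $$ (0, 0)"
      using T[OF g] assms[OF g] B(2) by (metis index_mult_mat_1)
    then show "\<rho> g $$ (0, 0) = \<sigma> g $$ (0, 0)" using T0 by simp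
  qed
next
  assume eq: "\<forall>g\<in>carrier G. \<rho> g $$ (0, 0) = \<sigma> g $$ (0, 0)"
  have "1\<^sub>m 1 \<in> Units (ring_mat TYPE(complex) 1 ())"
    by (auto simp: Units_def ring_mat_simps intro!: bexI[of _ "1\<^sub>m 1"])
  moreover have "\<rho> g = \<sigma> g" if "g \<in> carrier G" for g
    using eq assms that by (intro mat_1_eqI) auto
  then have "\<forall>g\<in>carrier G. 1\<^sub>m 1 * \<rho> g = \<sigma> g * 1\<^sub>m 1"
    using assms(2) by (metis left_mult_one_mat right_mult_one_mat)
  ultimately show "isomorphic_reps G 1 \<rho> 1 \<sigma>"
    by (auto simp: isomorphic_reps_def general_linear_def units_of_carrier)
qed

section \<open>The hitting time formula\<close>

text \<open>
  The sum is the value at \<open>\<one>\<close> of \<open>h x = (\<Sum>i. (1 - \<psi> i (x \<otimes> inv g)) / (1 - pf i))\<close>, which vanishes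
  at \<open>g\<close>. One step of the walk replaces \<open>x\<close> by \<open>s \<otimes> x\<close> with probability \<open>p s\<close> and so multiplies
  \<open>\<psi> i\<close> by \<open>pf i\<close> on average; what is left of \<open>h x - (P h) x\<close> is the negative of a sum of
  nontrivial characters at \<open>x \<otimes> inv g\<close>, which equals \<open>1\<close> for \<open>x \<noteq> g\<close>.
\<close>

lemma (in comm_group) expected_hitting_time_eq_character_sum:
  assumes fin: "finite (carrier G)" "finite I"
    and char: "\<And>i. i \<in> I \<Longrightarrow> group_character G (\<psi> i)"
    and complete: "\<And>\<phi>. group_character G \<phi> \<Longrightarrow> \<exists>!i. i \<in> I \<and> (\<forall>x\<in>carrier G. \<phi> x = \<psi> i x)"
    and i0: "i0 \<in> I" "\<And>x. x \<in> carrier G \<Longrightarrow> \<psi> i0 x = 1"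
    and p: "set_pmf p \<subseteq> carrier G"
    and irr: "irreducible_kernel (carrier G) (walk_kernel G p)"
    and mc: "markov_chain M (carrier G) (walk_kernel G p) \<one> X"
    and g: "g \<in> carrier G"
  shows "expected_hitting_time M X g < \<infinity>"
    and "complex_of_real (enn2real (expected_hitting_time M X g)) =
      (\<Sum>i\<in>I - {i0}. (1 - \<psi> i (inv g)) /
        (1 - (\<Sum>s\<in>carrier G. complex_of_real (pmf p s) * \<psi> i s)))"
proof -
  define pf where "pf i = (\<Sum>s\<in>carrier G. complex_of_real (pmf p s) * \<psi> i s)" for i
  have trivial: "group_character G (\<lambda>_. 1)" by (simp add: group_character_def)
  have pf_neq: "pf i \<noteq> 1" if i: "i \<in> I - {i0}" for i
  proof
    assume "pf i = 1"
    then have "\<forall>x\<in>carrier G. 1 = \<psi> i x"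
      using walk_fourier_eq_1_imp_trivial[OF fin(1) p irr char[of i]] i by (simp add: pf_def)
    moreover have "\<forall>x\<in>carrier G. 1 = \<psi> i0 x" using i0(2) by simp
    ultimately have "i = i0"
      using complete[OF trivial] i i0(1) by (metis DiffD1)
    then show False using i by simp
  qed
  define h where "h x = (\<Sum>i\<in>I - {i0}. (1 - \<psi> i (x \<otimes> inv g)) / (1 - pf i))" for x
  have "h g = 0"
    using g group_character_one[OF char] by (simp add: h_def)
  moreover have "h x = 1 + (\<Sum>y\<in>carrier G. complex_of_real (walk_kernel G p x y) * h y)"
    if x: "x \<in> carrier G" "x \<noteq> g" for x
  proof -
    have xg: "x \<otimes> inv g \<in> carrier G" "x \<otimes> inv g \<noteq> \<one>"
      using x g by (auto dest: inv_equality[OF _ g] simp: inv_solve_right')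
    have mean: "(\<Sum>s\<in>carrier G. complex_of_real (pmf p s) * (1 - \<psi> i (s \<otimes> x \<otimes> inv g))) =
        1 - pf i * \<psi> i (x \<otimes> inv g)" if "i \<in> I - {i0}" for i
    proof -
      have "\<psi> i (s \<otimes> x \<otimes> inv g) = \<psi> i s * \<psi> i (x \<otimes> inv g)" if "s \<in> carrier G" for s
        using char[of i] \<open>i \<in> I - {i0}\<close> that x g by (simp add: group_character_def m_assoc)
      then have "(\<Sum>s\<in>carrier G. complex_of_real (pmf p s) * (1 - \<psi> i (s \<otimes> x \<otimes> inv g))) =
          complex_of_real (\<Sum>s\<in>carrier G. pmf p s) - pf i * \<psi> i (x \<otimes> inv g)"
        by (simp add: pf_def right_diff_distrib sum_subtractf sum_distrib_right mult.assoc)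
      then show ?thesis using sum_pmf_eq_1[OF fin(1) p] by simp
    qed
    have "bij_betw (\<lambda>s. s \<otimes> x) (carrier G) (carrier G)"
      using x by (intro bij_betw_byWitness[where f' = "\<lambda>y. y \<otimes> inv x"]) (auto simp: m_assoc)
    then have "(\<Sum>y\<in>carrier G. complex_of_real (walk_kernel G p x y) * h y) =
        (\<Sum>s\<in>carrier G. complex_of_real (walk_kernel G p x (s \<otimes> x)) * h (s \<otimes> x))"
      by (rule sum.reindex_bij_betw[symmetric])
    also have "\<dots> = (\<Sum>s\<in>carrier G. complex_of_real (pmf p s) * h (s \<otimes> x))"
      using x by (intro sum.cong) (simp_all add: walk_kernel_def m_assoc)
    also have "\<dots> = (\<Sum>i\<in>I - {i0}. (\<Sum>s\<in>carrier G.
        complex_of_real (pmf p s) * (1 - \<psi> i (s \<otimes> x \<otimes> inv g))) / (1 - pf i))"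
      unfolding h_def sum_distrib_left by (subst sum.swap) (simp add: sum_divide_distrib)
    also have "\<dots> = (\<Sum>i\<in>I - {i0}. (1 - pf i * \<psi> i (x \<otimes> inv g)) / (1 - pf i))"
      by (intro sum.cong) (simp_all add: mean)
    also have "\<dots> = (\<Sum>i\<in>I - {i0}. (1 - \<psi> i (x \<otimes> inv g)) / (1 - pf i) + \<psi> i (x \<otimes> inv g))"
      using pf_neq by (intro sum.cong) (auto simp: field_simps)
    also have "\<dots> = h x + (\<Sum>i\<in>I - {i0}. \<psi> i (x \<otimes> inv g))"
      by (simp add: h_def sum.distrib)
    also have "(\<Sum>i\<in>I - {i0}. \<psi> i (x \<otimes> inv g)) = - 1"
    proof -
      have "(\<Sum>i\<in>I. \<psi> i (x \<otimes> inv g)) = 0"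
        by (rule sum_all_characters_eq_0[OF fin xg char complete])
      then show ?thesis
        using fin(2) i0(1) i0(2)[OF xg(1)]
        by (simp add: sum.remove[of I i0] eq_neg_iff_add_eq_0 add.commute)
    qed
    finally show ?thesis by simp
  qed
  moreover have "h \<one> = (\<Sum>i\<in>I - {i0}. (1 - \<psi> i (inv g)) / (1 - pf i))"
    using g by (simp add: h_def)
  ultimately show "expected_hitting_time M X g < \<infinity>"
    and "complex_of_real (enn2real (expected_hitting_time M X g)) =
      (\<Sum>i\<in>I - {i0}. (1 - \<psi> i (inv g)) /
        (1 - (\<Sum>s\<in>carrier G. complex_of_real (pmf p s) * \<psi> i s)))"
    using expected_hitting_time_eqI[OF mc fin(1), of h g] unfolding pf_def by metis+
qed

theorem theorem3p1:
  fixes G :: "('a, 'b) monoid_scheme"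
    and r :: nat and d :: "nat \<Rightarrow> nat" and \<rho> :: "nat \<Rightarrow> 'a \<Rightarrow> complex mat"
    and p :: "'a pmf" and M :: "'w measure" and X :: "nat \<Rightarrow> 'w \<Rightarrow> 'a"
  assumes "comm_group G" and "finite (carrier G)"
    and "irreps_list G r d \<rho>"
    and "d 1 = 1" and "\<forall>g\<in>carrier G. \<rho> 1 g = 1\<^sub>m 1"
    and "set_pmf p \<subseteq> carrier G"
    and "irreducible_kernel (carrier G) (walk_kernel G p)"
    and "markov_chain M (carrier G) (walk_kernel G p) \<one>\<^bsub>G\<^esub> X"
  shows "(\<forall>i\<in>{1..r}. d i = 1) \<and>
    (\<forall>g\<in>carrier G.
       expected_hitting_time M X g < \<infinity> \<and>
       complex_of_real (enn2real (expected_hitting_time M X g)) =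
         (\<Sum>i=2..r. (1 - \<rho> i (inv\<^bsub>G\<^esub> g) $$ (0, 0)) /
                     (1 - fourier G (\<lambda>h. complex_of_real (pmf p h)) (d i) (\<rho> i) $$ (0, 0))))"
proof -
  interpret comm_group G by fact
  have irr: "irreducible_rep G (d i) (\<rho> i)" if "i \<in> {1..r}" for i
    using assms(3) that by (simp add: irreps_list_def)
  have d: "d i = 1" if "i \<in> {1..r}" for i
    using irreducible_rep_degree[OF irr[OF that]] .
  have rep: "representation G 1 (\<rho> i)" if "i \<in> {1..r}" for i
    using irr[OF that] d[OF that] by (simp add: irreducible_rep_def)
  define \<psi> where "\<psi> i g = \<rho> i g $$ (0, 0)" for i g
  have char: "group_character G (\<psi> i)" if "i \<in> {1..r}" for i
    unfolding \<psi>_def using character_of_rep_1[OF rep[OF that]] .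
  have complete: "\<exists>!i. i \<in> {1..r} \<and> (\<forall>x\<in>carrier G. \<phi> x = \<psi> i x)" if "group_character G \<phi>" for \<phi>
  proof -
    have "\<exists>!i. i \<in> {1..r} \<and> isomorphic_reps G 1 (\<lambda>g. mat 1 1 (\<lambda>_. \<phi> g)) (d i) (\<rho> i)"
      using assms(3) rep_1_of_character[OF that] by (simp add: irreps_list_def)
    moreover have "isomorphic_reps G 1 (\<lambda>g. mat 1 1 (\<lambda>_. \<phi> g)) (d i) (\<rho> i) \<longleftrightarrow>
        (\<forall>x\<in>carrier G. \<phi> x = \<psi> i x)" if "i \<in> {1..r}" for i
      using isomorphic_reps_1_iff[of G "\<lambda>g. mat 1 1 (\<lambda>_. \<phi> g)" "\<rho> i"]
        representation_carrier[OF rep[OF that]] d[OF that]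
      by (simp add: \<psi>_def)
    ultimately show ?thesis by (simp cong: conj_cong)
  qed
  have "group_character G (\<lambda>_. 1)" by (simp add: group_character_def)
  then have "1 \<le> r" using complete by fastforce
  then have I: "1 \<in> {1..r}" "{2..r} = {1..r} - {1}" by auto
  have trivial: "\<psi> 1 x = 1" if "x \<in> carrier G" for x
    using assms(5) that by (simp add: \<psi>_def)
  have fourier: "fourier G (\<lambda>h. complex_of_real (pmf p h)) (d i) (\<rho> i) $$ (0, 0) =
      (\<Sum>s\<in>carrier G. complex_of_real (pmf p s) * \<psi> i s)" if "i \<in> {1..r} - {1}" for i
    using d[of i] that by (simp add: fourier_def \<psi>_def)
  note formula = expected_hitting_time_eq_character_sum
      [OF assms(2) finite_atLeastAtMost char complete I(1) trivial assms(6-8)]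
  show ?thesis
  proof (intro conjI ballI)
    fix g assume g: "g \<in> carrier G"
    show "expected_hitting_time M X g < \<infinity>"
      using formula(1)[OF _ _ _ g] by blast
    have "complex_of_real (enn2real (expected_hitting_time M X g)) =
        (\<Sum>i\<in>{1..r} - {1}. (1 - \<psi> i (inv\<^bsub>G\<^esub> g)) /
          (1 - (\<Sum>s\<in>carrier G. complex_of_real (pmf p s) * \<psi> i s)))"
      by (rule formula(2)[OF _ _ _ g])
    also have "\<dots> = (\<Sum>i\<in>{1..r} - {1}. (1 - \<rho> i (inv\<^bsub>G\<^esub> g) $$ (0, 0)) /
          (1 - fourier G (\<lambda>h. complex_of_real (pmf p h)) (d i) (\<rho> i) $$ (0, 0)))"
      by (intro sum.cong) (simp_all only: fourier \<psi>_def)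
    finally show "complex_of_real (enn2real (expected_hitting_time M X g)) =
        (\<Sum>i=2..r. (1 - \<rho> i (inv\<^bsub>G\<^esub> g) $$ (0, 0)) /
          (1 - fourier G (\<lambda>h. complex_of_real (pmf p h)) (d i) (\<rho> i) $$ (0, 0)))"
      unfolding I(2) .
  qed (rule d)
qed

end
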